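(* Let $\mathcal{F}$ be a free filter on $\mathbb{N}$. Then $\mathcal{F}$ has the simplified Schur property if and only if $\mathcal{F}$ is block-respecting.
   Context: A filter on $\mathbb{N}$ is free if it contains all subsets of $\mathbb{N}$ with finite complement. A sequence $(x_n)_{n\in\mathbb{N}}$ in a topological space $\mathcal{F}$-converges to $x$ if $\{n: x_n\in U\}\in\mathcal{F}$ for every neighborhood $U$ of $x$. A set $I\subset\mathbb{N}$ is $\mathcal{F}$-stationary if $I\cap A\neq\emptyset$ for every $A\in\mathcal{F}$; $\mathcal{F}^*$ denotes the collection of all $\mathcal{F}$-stationary sets. The space $\ell_1$ is the real Banach space of absolutely summable sequences. $\mathcal{F}$ has the simplified Schur property if for every sequence $(x_n)_{n\in\mathbb{N}}\subset\ell_1$ that converges coordinate-wise to $0$ (in the ordinary sense) and that $\mathcal{F}$-converges to $0$ in the weak topology of $\ell_1$, one has $\mathcal{F}\text{-}\lim\|x_n\|=0$. A blocking of an infinite set $I\subset\mathbb{N}$ is a partition $D=\{D_k\}_{k\in\mathbb{N}}$ of $I$ into pairwise disjoint non-empty finite subsets. $\mathcal{F}$ is block-respecting if for every $I\in\mathcal{F}^*$ and every blocking $D=\{D_k\}_{k\in\mathbb{N}}$ of $I$ there is $J\in\mathcal{F}^*$, $J\subset I$, such that $|J\cap D_k|=1$ for all $k$. *)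

theory Defs
  imports "HOL-Analysis.Analysis"
begin

section \<open>The real Banach space of absolutely summable sequences\<close>

typedef ell1 = "{a :: nat \<Rightarrow> real. summable (\<lambda>k. \<bar>a k\<bar>)}"
  morphisms coord Abs_ell1
  by (rule exI[of _ "\<lambda>_. 0"]) simp

setup_lifting type_definition_ell1

lemma summable_coord: "summable (\<lambda>k. \<bar>coord x k\<bar>)"
  using coord by blast

lemma ell1_eqI: "(\<And>k. coord x k = coord y k) \<Longrightarrow> x = y"
  by (metis coord_inject ext)

instantiation ell1 :: real_vector
begin

lift_definition zero_ell1 :: ell1 is "\<lambda>_. 0" by simp

lift_definition plus_ell1 :: "ell1 \<Rightarrow> ell1 \<Rightarrow> ell1" is "\<lambda>a b k. a k + b k"
  subgoal for a b
    by (rule summable_comparison_test'[of "\<lambda>k. \<bar>a k\<bar> + \<bar>b k\<bar>" 0])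
      (auto intro: summable_add)
  done

lift_definition uminus_ell1 :: "ell1 \<Rightarrow> ell1" is "\<lambda>a k. - a k" by simp

lift_definition minus_ell1 :: "ell1 \<Rightarrow> ell1 \<Rightarrow> ell1" is "\<lambda>a b k. a k - b k"
  subgoal for a b
    by (rule summable_comparison_test'[of "\<lambda>k. \<bar>a k\<bar> + \<bar>b k\<bar>" 0])
      (auto intro: summable_add)
  done

lift_definition scaleR_ell1 :: "real \<Rightarrow> ell1 \<Rightarrow> ell1" is "\<lambda>c a k. c * a k"
  by (simp add: abs_mult summable_mult)

instance
  by standard (transfer; auto simp: algebra_simps)+

end

lemmas coord_simps [simp] =
  zero_ell1.rep_eq plus_ell1.rep_eq uminus_ell1.rep_eq minus_ell1.rep_eq scaleR_ell1.rep_eq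

instantiation ell1 :: real_normed_vector
begin

definition norm_ell1 :: "ell1 \<Rightarrow> real"
  where "norm_ell1 x = (\<Sum>k. \<bar>coord x k\<bar>)"

definition sgn_ell1 :: "ell1 \<Rightarrow> ell1"
  where "sgn_ell1 x = x /\<^sub>R norm x"

definition dist_ell1 :: "ell1 \<Rightarrow> ell1 \<Rightarrow> real"
  where "dist_ell1 x y = norm (x - y)"

definition uniformity_ell1 :: "(ell1 \<times> ell1) filter"
  where "uniformity_ell1 = (INF e\<in>{0 <..}. principal {(x, y). dist x y < e})"

definition open_ell1 :: "ell1 set \<Rightarrow> bool"
  where "open_ell1 U = (\<forall>x\<in>U. \<forall>\<^sub>F (x', y) in uniformity. x' = x \<longrightarrow> y \<in> U)"

instance
proof
  fix x y :: ell1 and c :: real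
  show "(norm x = 0) = (x = 0)"
    using suminf_eq_zero_iff[OF summable_coord[of x]]
    by (auto simp: norm_ell1_def intro: ell1_eqI)
  have "norm (x + y) \<le> (\<Sum>k. \<bar>coord x k\<bar> + \<bar>coord y k\<bar>)"
    unfolding norm_ell1_def
    by (intro suminf_le summable_coord summable_add) (simp add: abs_triangle_ineq)
  also have "\<dots> = norm x + norm y"
    unfolding norm_ell1_def by (rule suminf_add[symmetric]; rule summable_coord)
  finally show "norm (x + y) \<le> norm x + norm y" .
  show "norm (c *\<^sub>R x) = \<bar>c\<bar> * norm x"
    by (simp add: norm_ell1_def abs_mult suminf_mult summable_coord)
qed (rule sgn_ell1_def dist_ell1_def uniformity_ell1_def open_ell1_def)+

end

lemma sum_coord_le_norm: "(\<Sum>k<N. \<bar>coord x k\<bar>) \<le> norm x"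
  unfolding norm_ell1_def by (rule sum_le_suminf) (auto intro: summable_coord)

lemma abs_coord_le_norm: "\<bar>coord x k\<bar> \<le> norm x"
proof -
  have "\<bar>coord x k\<bar> \<le> (\<Sum>j<Suc k. \<bar>coord x j\<bar>)"
    by (rule member_le_sum) auto
  then show ?thesis using sum_coord_le_norm[of x "Suc k"] by linarith
qed

instance ell1 :: banach
proof
  fix X :: "nat \<Rightarrow> ell1"
  assume X: "Cauchy X"
  have "Cauchy (\<lambda>n. coord (X n) k)" for k
  proof (rule metric_CauchyI)
    fix e :: real assume "e > 0"
    then obtain M where M: "\<forall>m\<ge>M. \<forall>n\<ge>M. dist (X m) (X n) < e"
      using X by (auto simp: Cauchy_def)
    have "dist (coord (X m) k) (coord (X n) k) \<le> dist (X m) (X n)" for m n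
      using abs_coord_le_norm[of "X m - X n" k] by (simp add: dist_norm)
    then show "\<exists>M. \<forall>m\<ge>M. \<forall>n\<ge>M. dist (coord (X m) k) (coord (X n) k) < e"
      using M by (meson le_less_trans)
  qed
  then have "\<exists>l. (\<lambda>n. coord (X n) k) \<longlonglongrightarrow> l" for k
    by (simp add: Cauchy_convergent_iff convergent_def)
  then obtain y where y: "\<And>k. (\<lambda>n. coord (X n) k) \<longlonglongrightarrow> y k" by metis
  have tail: "\<exists>M. \<forall>n\<ge>M. \<forall>N. (\<Sum>k<N. \<bar>coord (X n) k - y k\<bar>) \<le> e" if "e > 0" for e
  proof -
    obtain M where M: "\<forall>m\<ge>M. \<forall>n\<ge>M. dist (X m) (X n) < e"
      using X \<open>e > 0\<close> by (auto simp: Cauchy_def)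
    have "(\<Sum>k<N. \<bar>coord (X n) k - y k\<bar>) \<le> e" if n: "n \<ge> M" for n N
    proof (rule LIMSEQ_le_const2)
      show "(\<lambda>m. \<Sum>k<N. \<bar>coord (X n) k - coord (X m) k\<bar>) \<longlonglongrightarrow> (\<Sum>k<N. \<bar>coord (X n) k - y k\<bar>)"
        by (intro tendsto_intros y)
      have "(\<Sum>k<N. \<bar>coord (X n) k - coord (X m) k\<bar>) \<le> e" if "m \<ge> M" for m
      proof -
        have "dist (X n) (X m) < e" using M n that by blast
        then show ?thesis
          using sum_coord_le_norm[of "X n - X m" N] by (simp add: dist_norm)
      qed
      then show "\<exists>M. \<forall>m\<ge>M. (\<Sum>k<N. \<bar>coord (X n) k - coord (X m) k\<bar>) \<le> e" by blast
    qed
    then show ?thesis by blast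
  qed
  have summ: "summable (\<lambda>k. \<bar>coord (X n) k - y k\<bar>)"
    if "\<forall>N. (\<Sum>k<N. \<bar>coord (X n) k - y k\<bar>) \<le> e" for n e
    by (rule bounded_imp_summable[where B = e])
      (use that in \<open>simp_all del: sum.lessThan_Suc flip: lessThan_Suc_atMost\<close>)
  obtain M where "\<forall>N. (\<Sum>k<N. \<bar>coord (X M) k - y k\<bar>) \<le> 1"
    using tail[of 1] by auto
  from summ[OF this]
  have "summable (\<lambda>k. \<bar>y k\<bar>)"
    by (rule summable_comparison_test'[OF summable_add[OF _ summable_coord[of "X M"]], of _ 0])
      (auto simp: abs_if)
  then have coord_y: "coord (Abs_ell1 y) = y" by (simp add: Abs_ell1_inverse)
  have "X \<longlonglongrightarrow> Abs_ell1 y"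
  proof (rule metric_LIMSEQ_I)
    fix e :: real assume e: "e > 0"
    obtain M where M: "\<forall>n\<ge>M. \<forall>N. (\<Sum>k<N. \<bar>coord (X n) k - y k\<bar>) \<le> e / 2"
      using tail[of "e / 2"] e by auto
    have "dist (X n) (Abs_ell1 y) < e" if "n \<ge> M" for n
    proof -
      have b: "\<forall>N. (\<Sum>k<N. \<bar>coord (X n) k - y k\<bar>) \<le> e / 2" using M that by blast
      have "dist (X n) (Abs_ell1 y) \<le> e / 2"
        unfolding dist_norm norm_ell1_def minus_ell1.rep_eq coord_y
        by (rule suminf_le_const[OF summ[OF b]]) (use b in blast)
      then show ?thesis using e by simp
    qed
    then show "\<exists>M. \<forall>n\<ge>M. dist (X n) (Abs_ell1 y) < e" by blast
  qed
  then show "convergent X" by (rule convergentI)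
qed


section \<open>Weak topology\<close>

definition weak_topology :: "'a::real_normed_vector topology"
  where "weak_topology =
    topology_generated_by {f -` U | (f :: 'a \<Rightarrow> real) U. bounded_linear f \<and> open U}"

lemma topspace_weak_topology [simp]: "topspace weak_topology = UNIV"
proof -
  have "(UNIV :: 'a set) = (\<lambda>_. 0 :: real) -` UNIV" by simp
  then have "UNIV \<in> {f -` U | (f :: 'a \<Rightarrow> real) U. bounded_linear f \<and> open U}"
    using bounded_linear_zero open_UNIV by blast
  then show ?thesis unfolding weak_topology_def topology_generated_by_topspace by blast
qed


section \<open>Filters on the natural numbers\<close>

text \<open>
  A family of subsets of the naturals that is a filter is represented by an element of the
  library type \<^typ>\<open>nat filter\<close>: a set \<open>A\<close> belongs to the filter \<open>F\<close> iff
  \<open>eventually (\<lambda>n. n \<in> A) F\<close>.  Convergence along \<open>F\<close> is \<^const>\<open>limitin\<close> in a given topology,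
  which for metric spaces is \<^const>\<open>tendsto\<close>.  The type also contains the improper filter
  \<^term>\<open>bot\<close>, which has to be excluded separately.
\<close>

definition free_filter :: "nat filter \<Rightarrow> bool"
  where "free_filter F \<longleftrightarrow> (\<forall>A. finite (- A) \<longrightarrow> eventually (\<lambda>n. n \<in> A) F)"

definition stationary :: "nat filter \<Rightarrow> nat set \<Rightarrow> bool"
  where "stationary F I \<longleftrightarrow> (\<forall>A. eventually (\<lambda>n. n \<in> A) F \<longrightarrow> I \<inter> A \<noteq> {})"

definition simplified_schur :: "nat filter \<Rightarrow> bool"
  where "simplified_schur F \<longleftrightarrow>
    (\<forall>x :: nat \<Rightarrow> ell1.
      (\<forall>k. (\<lambda>n. coord (x n) k) \<longlonglongrightarrow> 0) \<longrightarrow>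
      limitin weak_topology x 0 F \<longrightarrow>
      ((\<lambda>n. norm (x n)) \<longlongrightarrow> 0) F)"

definition blocking :: "nat set \<Rightarrow> (nat \<Rightarrow> nat set) \<Rightarrow> bool"
  where "blocking I D \<longleftrightarrow>
    infinite I \<and> (\<Union>k. D k) = I \<and> disjoint_family D \<and> (\<forall>k. finite (D k) \<and> D k \<noteq> {})"

definition block_respecting :: "nat filter \<Rightarrow> bool"
  where "block_respecting F \<longleftrightarrow>
    (\<forall>I D. stationary F I \<longrightarrow> blocking I D \<longrightarrow>
      (\<exists>J. stationary F J \<and> J \<subseteq> I \<and> (\<forall>k. card (J \<inter> D k) = 1)))"

end

theory Submission
  imports Defs
begin

text \<open>
  A selector of a blocking turns into a gliding hump: if the norms of a coordinate-wise null
  sequence stay away from \<open>0\<close> on a stationary set, cut that set into intervals such that two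
  non-adjacent intervals have essentially disjointly supported terms.  A stationary selector
  splits into its even and its odd half, one of which is stationary, and a sign sequence adapted
  to that half is a functional that does not converge to \<open>0\<close> along the filter.

  Conversely, for a blocking \<open>D\<close> let \<open>x n\<close> with \<open>n \<in> D k\<close> be the Rademacher functions in the
  \<open>k\<close>-th copy of \<open>L\<^sub>1(Pow (D k))\<close>.  By orthogonality a functional is larger than \<open>e\<close> on a bounded
  number of terms of each block, so the set of such terms is covered by finitely many selectors.
\<close>

section \<open>Stationary sets\<close>

lemma stationary_iff_frequently: "stationary F I \<longleftrightarrow> frequently (\<lambda>n. n \<in> I) F"
proof
  assume I: "stationary F I"
  show "frequently (\<lambda>n. n \<in> I) F"
    unfolding frequently_def
  proof
    assume "eventually (\<lambda>n. n \<notin> I) F"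
    then have "eventually (\<lambda>n. n \<in> - I) F" by simp
    then show False using I unfolding stationary_def by blast
  qed
next
  assume I: "frequently (\<lambda>n. n \<in> I) F"
  show "stationary F I"
    unfolding stationary_def
  proof (intro allI impI notI)
    fix A assume A: "eventually (\<lambda>n. n \<in> A) F" and "I \<inter> A = {}"
    from A have "eventually (\<lambda>n. n \<notin> I) F"
      by (rule eventually_mono) (use \<open>I \<inter> A = {}\<close> in blast)
    then show False using I by (simp add: frequently_def)
  qed
qed

lemma stationary_infinite:
  assumes "free_filter F" "stationary F I"
  shows "infinite I"
proof
  assume "finite I"
  then have "eventually (\<lambda>n. n \<in> - I) F"
    using assms(1) unfolding free_filter_def by (metis double_complement)
  then show False using assms(2) unfolding stationary_def by blast
qed

lemma blocking_selector:
  assumes D: "blocking I D" and c: "\<And>k. c k \<in> D k"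
  shows "range c \<subseteq> I" and "range c \<inter> D k = {c k}" and "card (range c \<inter> D k) = 1"
proof -
  show "range c \<subseteq> I" using assms by (auto simp: blocking_def)
  have "c i \<in> D k \<Longrightarrow> i = k" for i
    using D c[of i] unfolding blocking_def disjoint_family_on_def by blast
  then show *: "range c \<inter> D k = {c k}" using c by auto
  show "card (range c \<inter> D k) = 1" by (simp add: *)
qed

text \<open>A set with at most \<open>M\<close> points in each block is covered by \<open>M\<close> selectors.\<close>

lemma stationary_selector_of_bounded:
  assumes D: "blocking I D"
    and "stationary F T" "T \<subseteq> I" "\<And>k. card (T \<inter> D k) \<le> M"
  shows "\<exists>J. stationary F J \<and> J \<subseteq> I \<and> (\<forall>k. card (J \<inter> D k) = 1)"
  using assms(2-)
proof (induction M arbitrary: T)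
  case 0
  have "T \<inter> D k = {}" for k
    using 0(3)[of k] D by (simp add: blocking_def)
  then have "T = {}" using 0(2) D unfolding blocking_def by blast
  then show ?case using 0(1) by (simp add: stationary_iff_frequently)
next
  case (Suc M)
  have "D k \<noteq> {}" for k using D by (simp add: blocking_def)
  \<comment> \<open>The point is taken from \<open>T\<close> whenever \<open>T\<close> meets the
    block, so that removing the selector lowers every positive count by one. In the other blocks any
    point will do. If \<open>range c\<close> is not stationary, then \<open>T - range c\<close> must
    be, because a union of two sets is stationary only if one of them is.\<close>
  then have "\<exists>c. c \<in> D k \<and> (T \<inter> D k \<noteq> {} \<longrightarrow> c \<in> T)" for k
    by (metis disjoint_iff ex_in_conv)
  then obtain c where c: "\<And>k. c k \<in> D k" "\<And>k. T \<inter> D k \<noteq> {} \<Longrightarrow> c k \<in> T"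
    by metis
  note J = blocking_selector[of I D c, OF D c(1)]
  show ?case
  proof (cases "stationary F (range c)")
    case True
    then show ?thesis using J by blast
  next
    case False
    have "frequently (\<lambda>n. n \<in> T - range c \<or> n \<in> range c) F"
      by (rule frequently_mono[OF _ Suc.prems(1)[unfolded stationary_iff_frequently]]) blast
    then have "stationary F (T - range c)"
      using False unfolding frequently_disj_iff stationary_iff_frequently by blast
    moreover have "card ((T - range c) \<inter> D k) \<le> M" for k
    proof (cases "T \<inter> D k = {}")
      case True
      then have "(T - range c) \<inter> D k = {}" by blast
      then show ?thesis by simp
    next
      case False
      have "(T - range c) \<inter> D k = (T \<inter> D k) - {c k}" using J(2)[of k] by blast
      moreover have "c k \<in> T \<inter> D k" using c False by blast
      ultimately show ?thesis
        using Suc.prems(3)[of k] D by (simp add: blocking_def)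
    qed
    ultimately show ?thesis
      using Suc.IH[of "T - range c"] Suc.prems(2) by blast
  qed
qed

section \<open>Weak convergence\<close>

text \<open>The preimages under functionals are only a subbase. The converse is therefore an
  induction on the generation of open sets: the claim survives binary intersections and arbitrary
  unions.\<close>

lemma limitin_weak_topology_iff:
  "limitin weak_topology x l F \<longleftrightarrow>
    (\<forall>f :: 'a::real_normed_vector \<Rightarrow> real. bounded_linear f \<longrightarrow> ((\<lambda>n. f (x n)) \<longlongrightarrow> f l) F)"
proof (intro iffI allI impI)
  fix f :: "'a \<Rightarrow> real"
  assume x: "limitin weak_topology x l F" and f: "bounded_linear f"
  show "((\<lambda>n. f (x n)) \<longlongrightarrow> f l) F"
  proof (rule topological_tendstoI)
    fix U assume U: "open U" "f l \<in> U"
    then have "openin weak_topology (f -` U)"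
      unfolding weak_topology_def using f by (blast intro: topology_generated_by_Basis)
    then show "eventually (\<lambda>n. f (x n) \<in> U) F"
      using x U(2) by (auto simp: limitin_def)
  qed
next
  assume x: "\<forall>f :: 'a \<Rightarrow> real. bounded_linear f \<longrightarrow> ((\<lambda>n. f (x n)) \<longlongrightarrow> f l) F"
  have "l \<in> U \<longrightarrow> eventually (\<lambda>n. x n \<in> U) F" if "openin weak_topology U" for U
  proof -
    have "generate_topology_on {f -` U | (f :: 'a \<Rightarrow> real) U. bounded_linear f \<and> open U} U"
      using that by (simp add: weak_topology_def openin_topology_generated_by_iff)
    then show ?thesis
    proof induction
      case Empty
      then show ?case by simp
    next
      case (Int a b)
      then show ?case by (auto intro: eventually_conj)
    next
      case (UN K)
      then show ?case by (blast intro: eventually_mono)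
    next
      case (Basis s)
      then obtain f :: "'a \<Rightarrow> real" and V where "s = f -` V" "bounded_linear f" "open V" by blast
      then show ?case using x by (auto dest: topological_tendstoD)
    qed
  qed
  then show "limitin weak_topology x l F" by (simp add: limitin_def)
qed

section \<open>Gliding humps\<close>

lemma summable_mult_coord:
  assumes "\<And>j. \<bar>g j\<bar> \<le> 1"
  shows "summable (\<lambda>j. g j * coord x j)"
proof (rule summable_comparison_test'[OF summable_coord[of x], of 0])
  show "norm (g j * coord x j) \<le> \<bar>coord x j\<bar>" for j
    using mult_right_mono[OF assms[of j], of "\<bar>coord x j\<bar>"] by (simp add: abs_mult)
qed

text \<open>Sequences in the unit ball of l_infinity act on \<open>ell1\<close> by pairing. Every
  functional of the gliding hump argument is of this form.\<close>

lemma bounded_linear_suminf_coord: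
  assumes "\<And>j. \<bar>g j\<bar> \<le> 1"
  shows "bounded_linear (\<lambda>x. \<Sum>j. g j * coord x j)"
proof (rule bounded_linear_intro[where K = 1])
  note s = summable_mult_coord[of g, OF assms]
  fix x y :: ell1 and r :: real
  show "(\<Sum>j. g j * coord (x + y) j) = (\<Sum>j. g j * coord x j) + (\<Sum>j. g j * coord y j)"
    by (simp add: suminf_add[OF s s] algebra_simps)
  show "(\<Sum>j. g j * coord (r *\<^sub>R x) j) = r *\<^sub>R (\<Sum>j. g j * coord x j)"
    using suminf_mult[OF s, of r x] by (simp add: mult.left_commute)
  have le: "norm (g j * coord x j) \<le> \<bar>coord x j\<bar>" for j
    using mult_right_mono[OF assms[of j], of "\<bar>coord x j\<bar>"] by (simp add: abs_mult)
  show "norm (\<Sum>j. g j * coord x j) \<le> norm x * 1"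
    using norm_suminf_le[OF le summable_coord] by (simp add: norm_ell1_def)
qed

text \<open>All but \<open>2 * e\<close> of the mass of \<open>x\<close> lies in the window from
  \<open>m\<close> to \<open>m'\<close>. There \<open>g\<close> recovers the full absolute value;
  elsewhere it loses at most as much as is present. The outside mass is thus counted twice, once as
  missing and once as negative, which gives \<open>4 * e\<close>.\<close>

lemma suminf_sign_ge:
  assumes g: "\<And>j. \<bar>g j\<bar> \<le> 1"
    and sgn: "\<And>j. m \<le> j \<Longrightarrow> j < m' \<Longrightarrow> g j = sgn (coord x j)"
    and head: "(\<Sum>j<m. \<bar>coord x j\<bar>) \<le> e"
    and tail: "norm x - (\<Sum>j<m'. \<bar>coord x j\<bar>) \<le> e"
  shows "norm x - 4 * e \<le> (\<Sum>j. g j * coord x j)"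
proof -
  define a where "a = coord x"
  have cut: "(\<lambda>j. if j < i then \<bar>a j\<bar> else 0) sums (\<Sum>j<i. \<bar>a j\<bar>)" for i
    using sums_If_finite_set[of "{..<i}" "\<lambda>j. \<bar>a j\<bar>"] by simp
  have all: "(\<lambda>j. \<bar>a j\<bar>) sums norm x"
    unfolding norm_ell1_def a_def by (rule summable_sums[OF summable_coord])
  \<comment> \<open>A termwise minorant: it is \<open>\<bar>a j\<bar>\<close> inside the window and
    \<open>- \<bar>a j\<bar>\<close> outside. Should \<open>m' < m\<close> hold, it is
    \<open>- 3 * \<bar>a j\<bar>\<close> between them, still a lower bound.\<close>
  have "(\<lambda>j. 2 * (if j < m' then \<bar>a j\<bar> else 0) - 2 * (if j < m then \<bar>a j\<bar> else 0) - \<bar>a j\<bar>)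
      sums (2 * (\<Sum>j<m'. \<bar>a j\<bar>) - 2 * (\<Sum>j<m. \<bar>a j\<bar>) - norm x)"
    by (intro sums_diff sums_mult cut all)
  moreover have "(\<lambda>j. g j * a j) sums (\<Sum>j. g j * a j)"
    unfolding a_def by (rule summable_sums[OF summable_mult_coord[OF g]])
  moreover have "2 * (if j < m' then \<bar>a j\<bar> else 0) - 2 * (if j < m then \<bar>a j\<bar> else 0) - \<bar>a j\<bar>
      \<le> g j * a j" for j
  proof -
    have "\<bar>g j * a j\<bar> \<le> \<bar>a j\<bar>"
      using mult_right_mono[OF g[of j], of "\<bar>a j\<bar>"] by (simp add: abs_mult)
    moreover have "m \<le> j \<Longrightarrow> j < m' \<Longrightarrow> g j * a j = \<bar>a j\<bar>"
      using sgn[of j] by (simp add: a_def abs_sgn mult.commute)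
    ultimately show ?thesis by (cases "m \<le> j"; cases "j < m'") auto
  qed
  ultimately have "2 * (\<Sum>j<m'. \<bar>a j\<bar>) - 2 * (\<Sum>j<m. \<bar>a j\<bar>) - norm x \<le> (\<Sum>j. g j * a j)"
    by (rule sums_le[rotated])
  then show ?thesis using head tail by (simp add: a_def)
qed

text \<open>Index cuts \<open>N\<close> and coordinate cuts \<open>m\<close> are chosen alternately.
  The next \<open>N\<close> is so late that from there on little mass lies below the current
  \<open>m\<close>; the next \<open>m\<close> is so far out that the finitely many earlier terms
  have small tails. A term with index in the \<open>k\<close>-th interval then lives, up to
  \<open>e\<close> at either end, between \<open>m (k - 1)\<close> and
  \<open>m (Suc k)\<close>.\<close>

lemma gliding_hump_cuts:
  fixes x :: "nat \<Rightarrow> ell1"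
  assumes x: "\<And>k. (\<lambda>n. coord (x n) k) \<longlonglongrightarrow> 0" and I: "infinite I" and e: "e > 0"
  obtains N m :: "nat \<Rightarrow> nat" where "N 0 = 0" "strict_mono N" "mono m"
    "\<And>k. I \<inter> {N k..<N (Suc k)} \<noteq> {}"
    "\<And>k n. N k \<le> n \<Longrightarrow> (\<Sum>j<m (k - 1). \<bar>coord (x n) j\<bar>) \<le> e"
    "\<And>k n. n < N k \<Longrightarrow> norm (x n) - (\<Sum>j<m k. \<bar>coord (x n) j\<bar>) \<le> e"
proof -
  define hd where "hd n i = (\<Sum>j<i. \<bar>coord (x n) j\<bar>)" for n i
  \<comment> \<open>\<open>Q p q\<close> states that \<open>q\<close> is an admissible next pair
    (index cut, coordinate cut) after \<open>p\<close>. Iterating a choice function from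
    \<open>(0, 0)\<close> yields both sequences; this start makes the head at \<open>k = 0\<close>
    an empty sum.\<close>
  define Q where "Q p q \<longleftrightarrow> fst p < fst q \<and> snd p \<le> snd q \<and> I \<inter> {fst p..<fst q} \<noteq> {} \<and>
    (\<forall>n\<ge>fst q. hd n (snd p) \<le> e) \<and> (\<forall>n<fst q. norm (x n) - hd n (snd q) \<le> e)"
    for p q :: "nat \<times> nat"
  have "\<exists>q. Q p q" for p
  proof -
    obtain i where i: "i \<in> I" "fst p \<le> i"
      using I by (auto simp: infinite_nat_iff_unbounded_le)
    have "(\<lambda>n. hd n (snd p)) \<longlonglongrightarrow> (\<Sum>j<snd p. \<bar>0\<bar>)"
      unfolding hd_def by (intro tendsto_intros x)
    then have "eventually (\<lambda>n. hd n (snd p) < e) sequentially"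
      using e by (auto intro: order_tendstoD)
    then obtain N1 where N1: "\<And>n. n \<ge> N1 \<Longrightarrow> hd n (snd p) < e"
      by (auto simp: eventually_sequentially)
    \<comment> \<open>\<open>Suc i\<close> puts a point of \<open>I\<close> into the new interval,
      \<open>N1\<close> makes the later heads small.\<close>
    define N where "N = max (Suc i) N1"
    have "eventually (\<lambda>i. norm (x n) - hd n i < e) sequentially" for n
    proof -
      have "(\<lambda>i. hd n i) \<longlonglongrightarrow> norm (x n)"
        unfolding hd_def norm_ell1_def by (rule summable_LIMSEQ[OF summable_coord])
      then have "(\<lambda>i. norm (x n) - hd n i) \<longlonglongrightarrow> norm (x n) - norm (x n)"
        by (intro tendsto_intros)
      then show ?thesis using e by (auto intro: order_tendstoD)
    qed
    then have "eventually (\<lambda>i. (\<forall>n\<in>{..<N}. norm (x n) - hd n i < e) \<and> snd p \<le> i) sequentially"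
      by (intro eventually_conj eventually_ball_finite eventually_ge_at_top) auto
    then obtain m where "\<forall>n\<in>{..<N}. norm (x n) - hd n m < e" "snd p \<le> m"
      by (auto simp: eventually_sequentially)
    then have "Q p (N, m)"
      using i N1 by (auto simp: Q_def N_def less_imp_le intro: exI[of _ i])
    then show ?thesis ..
  qed
  then obtain s where s: "\<And>p. Q p (s p)" by metis
  define p where "p k = (s ^^ k) (0, 0)" for k
  have p0: "p 0 = (0, 0)" and pS: "Q (p k) (p (Suc k))" for k
    using s by (simp_all add: p_def)
  show ?thesis
  proof (rule that[of "fst \<circ> p" "snd \<circ> p"])
    fix k n
    show "(\<Sum>j<(snd \<circ> p) (k - 1). \<bar>coord (x n) j\<bar>) \<le> e" if "(fst \<circ> p) k \<le> n"
    proof (cases k)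
      case 0
      then show ?thesis using e by (simp add: p0)
    next
      case (Suc i)
      then show ?thesis using pS[of i] that by (simp add: Q_def hd_def)
    qed
    show "norm (x n) - (\<Sum>j<(snd \<circ> p) k. \<bar>coord (x n) j\<bar>) \<le> e" if "n < (fst \<circ> p) k"
    proof (cases k)
      case 0
      then show ?thesis using that by (simp add: p0)
    next
      case (Suc i)
      then show ?thesis using pS[of i] that by (simp add: Q_def hd_def)
    qed
  qed (use pS p0 in \<open>auto simp: Q_def strict_mono_Suc_iff mono_iff_le_Suc\<close>)
qed

lemma disjoint_family_intervals:
  fixes N :: "nat \<Rightarrow> nat"
  assumes "mono N"
  shows "disjoint_family (\<lambda>k. {N k..<N (Suc k)})"
proof -
  have "i = j" if "n \<in> {N i..<N (Suc i)}" "n \<in> {N j..<N (Suc j)}" for i j n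
  proof (rule ccontr)
    assume "i \<noteq> j"
    then have "Suc i \<le> j \<or> Suc j \<le> i" by linarith
    then have "N (Suc i) \<le> N j \<or> N (Suc j) \<le> N i" using assms by (auto dest: monoD)
    then show False using that by auto
  qed
  then show ?thesis unfolding disjoint_family_on_def by blast
qed

lemma UN_intervals:
  fixes N :: "nat \<Rightarrow> nat"
  assumes "strict_mono N" "N 0 = 0"
  shows "(\<Union>k. {N k..<N (Suc k)}) = UNIV"
proof -
  have "n < N k \<Longrightarrow> \<exists>i. n \<in> {N i..<N (Suc i)}" for n k
  proof (induction k)
    case (Suc k)
    show ?case
    proof (cases "n < N k")
      case True
      then show ?thesis by (rule Suc.IH)
    next
      case False
      then have "n \<in> {N k..<N (Suc k)}" using Suc.prems by simp
      then show ?thesis ..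
    qed
  qed (simp add: assms(2))
  moreover have "n < N (Suc n)" for n
    using strict_mono_imp_increasing[OF assms(1), of "Suc n"] by simp
  ultimately show ?thesis by blast
qed

text \<open>The windows of consecutive \<open>k\<close> overlap, but those of indices of equal
  parity are disjoint. Hence one sequence \<open>g\<close> can carry the signs of all the chosen
  terms at once.\<close>

lemma hump_functional:
  fixes x :: "nat \<Rightarrow> ell1" and m :: "nat \<Rightarrow> nat"
  assumes "mono m"
    and head: "\<And>k. (\<Sum>j<m (k - 1). \<bar>coord (x k) j\<bar>) \<le> e"
    and tail: "\<And>k. norm (x k) - (\<Sum>j<m (Suc k). \<bar>coord (x k) j\<bar>) \<le> e"
    and parity: "\<And>i k. i \<in> K \<Longrightarrow> k \<in> K \<Longrightarrow> even (i + k)"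
  shows "\<exists>f :: ell1 \<Rightarrow> real. bounded_linear f \<and> (\<forall>k\<in>K. norm (x k) - 4 * e \<le> f (x k))"
proof -
  let ?P = "\<lambda>j k. k \<in> K \<and> m (k - 1) \<le> j \<and> j < m (Suc k)"
  have le: "\<not> i < k" if "?P j i" "?P j k" for i j k
  proof
    assume "i < k"
    \<comment> \<open>Equal parity forces a gap of at least two, so the window of \<open>i\<close>
      ends no later than that of \<open>k\<close> begins.\<close>
    moreover have "k \<noteq> Suc i" using parity[of i k] that by auto
    ultimately have "Suc i \<le> k - 1" by linarith
    then have "m (Suc i) \<le> m (k - 1)" using \<open>mono m\<close> by (rule monoD[rotated])
    then show False using that by linarith
  qed
  have uniq: "i = k" if "?P j i" "?P j k" for i j k
    using le[OF that] le[OF that(2,1)] by linarith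
  define g where
    "g j = (if \<exists>k. ?P j k then sgn (coord (x (THE k. ?P j k)) j) else 0)" for j
  have g: "\<bar>g j\<bar> \<le> 1" for j
    by (simp add: g_def sgn_if)
  have g_eq: "g j = sgn (coord (x k) j)" if "?P j k" for j k
  proof -
    have "(THE k. ?P j k) = k" using that uniq by blast
    then show ?thesis using that unfolding g_def by auto
  qed
  show ?thesis
  proof (intro exI conjI ballI)
    show "bounded_linear (\<lambda>x. \<Sum>j. g j * coord x j)"
      by (rule bounded_linear_suminf_coord) (rule g)
    fix k assume "k \<in> K"
    then show "norm (x k) - 4 * e \<le> (\<Sum>j. g j * coord (x k) j)"
      using suminf_sign_ge[of g "m (k - 1)" "m (Suc k)" "x k" e, OF g g_eq head tail] by blast
  qed
qed

section \<open>From stationary selectors to norm convergence\<close>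

lemma block_respecting_imp_simplified_schur:
  assumes free: "free_filter F" and F: "block_respecting F"
  shows "simplified_schur F"
  unfolding simplified_schur_def
proof (intro allI impI)
  fix x :: "nat \<Rightarrow> ell1"
  assume x: "\<forall>k. (\<lambda>n. coord (x n) k) \<longlonglongrightarrow> 0" and weak: "limitin weak_topology x 0 F"
  show "((\<lambda>n. norm (x n)) \<longlongrightarrow> 0) F"
  proof (rule ccontr)
    assume "\<not> ?thesis"
    then obtain e where e: "e > 0" "\<not> eventually (\<lambda>n. norm (x n) < e) F"
      by (auto simp: tendsto_iff)
    define I where "I = {n. e \<le> norm (x n)}"
    have I: "stationary F I"
      using e(2) by (simp add: stationary_iff_frequently frequently_def I_def not_le)
    have inf: "infinite I" by (rule stationary_infinite[OF free I])
    \<comment> \<open>With error \<open>e / 8\<close> the sign functional loses at most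
      \<open>e / 2\<close>, so it stays at least \<open>e / 2\<close> on terms of norm at least
      \<open>e\<close>.\<close>
    obtain N m where N: "N 0 = 0" "strict_mono N" and m: "mono m"
      and ne: "\<And>k. I \<inter> {N k..<N (Suc k)} \<noteq> {}"
      and head: "\<And>k n. N k \<le> n \<Longrightarrow> (\<Sum>j<m (k - 1). \<bar>coord (x n) j\<bar>) \<le> e / 8"
      and tail: "\<And>k n. n < N k \<Longrightarrow> norm (x n) - (\<Sum>j<m k. \<bar>coord (x n) j\<bar>) \<le> e / 8"
      using gliding_hump_cuts[of x I "e / 8"] x inf e(1) by auto
    define D where "D k = I \<inter> {N k..<N (Suc k)}" for k
    have D: "blocking I D"
      unfolding blocking_def
    proof (intro conjI allI inf)
      show "(\<Union>k. D k) = I" using UN_intervals[OF N(2,1)] unfolding D_def by blast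
      show "disjoint_family D"
        using disjoint_family_intervals[OF strict_mono_mono[OF N(2)]]
        unfolding D_def disjoint_family_on_def by blast
      show "finite (D k)" "D k \<noteq> {}" for k using ne by (auto simp: D_def)
    qed
    then obtain J where J: "stationary F J" "J \<subseteq> I" "\<And>k. card (J \<inter> D k) = 1"
      using F I unfolding block_respecting_def by metis
    then have "\<forall>k. \<exists>n. J \<inter> D k = {n}" by (simp add: card_1_singleton_iff)
    then obtain c where c: "\<And>k. J \<inter> D k = {c k}" by metis
    have J_eq: "\<exists>k. n = c k" if "n \<in> J" for n
      using that J(2) D c unfolding blocking_def by blast
    \<comment> \<open>A selection from blocks of one parity admits a functional that is at least
      \<open>e / 2\<close> on all of it, so weak convergence prevents it from being
      stationary.\<close>
    have not_freq: "\<not> frequently (\<lambda>n. n \<in> c ` K) F"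
      if par: "\<And>i k. i \<in> K \<Longrightarrow> k \<in> K \<Longrightarrow> even (i + k)" for K
    proof -
      have cD: "c k \<in> D k" for k using c[of k] by blast
      have "(\<Sum>j<m (k - 1). \<bar>coord (x (c k)) j\<bar>) \<le> e / 8" for k
        by (rule head) (use cD[of k] in \<open>simp add: D_def\<close>)
      moreover have "norm (x (c k)) - (\<Sum>j<m (Suc k). \<bar>coord (x (c k)) j\<bar>) \<le> e / 8" for k
        by (rule tail) (use cD[of k] in \<open>simp add: D_def\<close>)
      ultimately have "\<exists>f :: ell1 \<Rightarrow> real. bounded_linear f \<and>
          (\<forall>k\<in>K. norm (x (c k)) - 4 * (e / 8) \<le> f (x (c k)))"
        by (rule hump_functional[OF m _ _ par])
      then obtain f :: "ell1 \<Rightarrow> real" where f: "bounded_linear f"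
        "\<And>k. k \<in> K \<Longrightarrow> norm (x (c k)) - 4 * (e / 8) \<le> f (x (c k))"
        by blast
      have "((\<lambda>n. f (x n)) \<longlongrightarrow> 0) F"
        using weak f(1) by (auto simp: limitin_weak_topology_iff linear_simps)
      then have "eventually (\<lambda>n. f (x n) < e / 2) F"
        by (rule order_tendstoD) (simp add: e(1))
      moreover have "e / 2 \<le> f (x n)" if n: "n \<in> c ` K" for n
      proof -
        obtain k where k: "k \<in> K" "n = c k" using n by blast
        have "e \<le> norm (x (c k))" using cD[of k] by (simp add: D_def I_def)
        then show ?thesis using f(2)[OF k(1)] k(2) by simp
      qed
      ultimately have "eventually (\<lambda>n. n \<notin> c ` K) F"
        by (metis (mono_tags, lifting) eventually_mono not_le)
      then show ?thesis by (simp add: frequently_def)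
    qed
    have "frequently (\<lambda>n. n \<in> c ` {k. even k} \<or> n \<in> c ` {k. odd k}) F"
      by (rule frequently_mono[OF _ J(1)[unfolded stationary_iff_frequently]])
        (use J_eq in blast)
    then show False
      unfolding frequently_disj_iff using not_freq by fastforce
  qed
qed

section \<open>Rademacher vectors\<close>

text \<open>Under the uniform measure on the subsets of a finite set, these functions, for
  \<open>n\<close> in that set, are independent random signs.\<close>

definition rademacher :: "nat \<Rightarrow> nat set \<Rightarrow> real"
  where "rademacher n S = (if n \<in> S then 1 else - 1)"

lemma sum_Pow_insert:
  assumes "finite A" "d \<notin> A"
  shows "(\<Sum>S\<in>Pow (insert d A). h S) = (\<Sum>S\<in>Pow A. h S + h (insert d S))"
proof -
  have "inj_on (insert d) (Pow A)"
    using assms(2) by (auto simp: inj_on_def insert_ident)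
  moreover have "Pow A \<inter> insert d ` Pow A = {}" using assms(2) by blast
  ultimately show ?thesis
    using assms(1)
    by (simp add: Pow_insert sum.union_disjoint sum.reindex sum.distrib)
qed

text \<open>Parseval's identity for the random signs. The constant \<open>c\<close> makes the
  induction work: splitting the subsets by membership of the new point \<open>d\<close> shifts
  \<open>c\<close> by plus or minus \<open>t d\<close>, and the cross terms cancel.\<close>

lemma sum_Pow_rademacher_square:
  assumes "finite A"
  shows "(\<Sum>S\<in>Pow A. (c + (\<Sum>n\<in>A. t n * rademacher n S))\<^sup>2) = 2 ^ card A * (c\<^sup>2 + (\<Sum>n\<in>A. (t n)\<^sup>2))"
  using assms
proof (induction A arbitrary: c)
  case empty
  then show ?case by simp
next
  case (insert d A)
  let ?r = "\<lambda>S. \<Sum>n\<in>A. t n * rademacher n S"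
  have 1: "(\<Sum>n\<in>insert d A. t n * rademacher n S) = - t d + ?r S" if "S \<in> Pow A" for S
    using that insert.hyps by (auto simp: rademacher_def)
  have "?r (insert d S) = ?r S" for S
    using insert.hyps by (intro sum.cong) (auto simp: rademacher_def)
  then have 2: "(\<Sum>n\<in>insert d A. t n * rademacher n (insert d S)) = t d + ?r S" for S
    using insert.hyps by (simp add: rademacher_def)
  have "(\<Sum>S\<in>Pow (insert d A). (c + (\<Sum>n\<in>insert d A. t n * rademacher n S))\<^sup>2)
    = (\<Sum>S\<in>Pow A. ((c - t d) + ?r S)\<^sup>2 + ((c + t d) + ?r S)\<^sup>2)"
    unfolding sum_Pow_insert[OF insert.hyps]
    by (intro sum.cong refl) (simp only: 1 2 add.assoc diff_conv_add_uminus)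
  also have "\<dots> = 2 ^ card A * ((c - t d)\<^sup>2 + (\<Sum>n\<in>A. (t n)\<^sup>2))
      + 2 ^ card A * ((c + t d)\<^sup>2 + (\<Sum>n\<in>A. (t n)\<^sup>2))"
    by (simp only: sum.distrib insert.IH)
  also have "\<dots> = 2 ^ card (insert d A) * (c\<^sup>2 + (\<Sum>n\<in>insert d A. (t n)\<^sup>2))"
    using insert.hyps by (simp add: power2_eq_square algebra_simps)
  finally show ?case .
qed

text \<open>The L1 norm is at most the L2 norm on a probability space: Cauchy-Schwarz against the
  constant 1, then Parseval.\<close>

lemma sum_Pow_rademacher_abs_le:
  assumes "finite A"
  shows "(\<Sum>S\<in>Pow A. \<bar>\<Sum>n\<in>A. t n * rademacher n S\<bar>) \<le> 2 ^ card A * sqrt (\<Sum>n\<in>A. (t n)\<^sup>2)"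
proof -
  let ?r = "\<lambda>S. \<Sum>n\<in>A. t n * rademacher n S"
  have "(\<Sum>S\<in>Pow A. \<bar>?r S\<bar>)\<^sup>2 \<le> (\<Sum>S\<in>Pow A. 1\<^sup>2) * (\<Sum>S\<in>Pow A. \<bar>?r S\<bar>\<^sup>2)"
    using Cauchy_Schwarz_ineq_sum[of "\<lambda>_. 1" "\<lambda>S. \<bar>?r S\<bar>" "Pow A"] by simp
  also have "\<dots> = (2 ^ card A)\<^sup>2 * (\<Sum>n\<in>A. (t n)\<^sup>2)"
    using sum_Pow_rademacher_square[OF assms, of 0 t] assms
    by (simp add: card_Pow power2_eq_square)
  also have "\<dots> = (2 ^ card A * sqrt (\<Sum>n\<in>A. (t n)\<^sup>2))\<^sup>2"
    by (simp add: power_mult_distrib sum_nonneg)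
  finally show ?thesis by (rule power2_le_imp_le) (simp add: sum_nonneg)
qed

text \<open>The coordinates are indexed by pairs of a block number and a finite set.\<close>

definition block_index :: "nat \<Rightarrow> nat set \<Rightarrow> nat"
  where "block_index k S = prod_encode (k, set_encode S)"

lemma inj_on_block_index: "finite A \<Longrightarrow> inj_on (block_index k) (Pow A)"
  by (rule inj_onI)
    (simp add: block_index_def prod_encode_eq set_encode_eq[THEN iffD1] finite_subset)

text \<open>Dividing by \<open>2 ^ card (D k)\<close> turns counting measure on
  \<open>Pow (D k)\<close> into a probability measure, and different blocks use different
  coordinates.\<close>

definition rademacher_coord :: "(nat \<Rightarrow> nat set) \<Rightarrow> nat \<Rightarrow> nat \<Rightarrow> real"
  where "rademacher_coord D n j = (let (k, s) = prod_decode j; S = set_decode s in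
    if n \<in> D k \<and> S \<subseteq> D k then rademacher n S / 2 ^ card (D k) else 0)"

definition rademacher_vector :: "(nat \<Rightarrow> nat set) \<Rightarrow> nat \<Rightarrow> ell1"
  where "rademacher_vector D n = Abs_ell1 (rademacher_coord D n)"

lemma rademacher_coord_block_index:
  assumes "n \<in> D k" "finite S" "S \<subseteq> D k"
  shows "rademacher_coord D n (block_index k S) = rademacher n S / 2 ^ card (D k)"
  using assms by (simp add: rademacher_coord_def block_index_def)

section \<open>Rademacher vectors of a fixed blocking\<close>

context
  fixes I :: "nat set" and D :: "nat \<Rightarrow> nat set"
  assumes D: "blocking I D"
begin

lemma finite_block: "finite (D k)"
  using D by (simp add: blocking_def)

lemma rademacher_coord_outside:
  assumes "n \<in> D k" "j \<notin> block_index k ` Pow (D k)"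
  shows "rademacher_coord D n j = 0"
proof (rule ccontr)
  assume nz: "rademacher_coord D n j \<noteq> 0"
  obtain i s where j: "prod_decode j = (i, s)" by fastforce
  then have *: "n \<in> D i" "set_decode s \<subseteq> D i"
    using nz by (auto simp: rademacher_coord_def Let_def split: if_splits)
  then have "i = k"
    using D assms(1) unfolding blocking_def disjoint_family_on_def by blast
  have "j = block_index k (set_decode s)"
    using j \<open>i = k\<close> by (metis block_index_def prod_decode_inverse set_decode_inverse)
  then show False using assms(2) * \<open>i = k\<close> by blast
qed

lemma coord_rademacher_vector: "coord (rademacher_vector D n) = rademacher_coord D n"
proof -
  have "summable (\<lambda>j. \<bar>rademacher_coord D n j\<bar>)"
  proof (cases "\<exists>k. n \<in> D k")
    case True
    then obtain k where "n \<in> D k" ..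
    then show ?thesis
      by (intro summable_finite[of "block_index k ` Pow (D k)"])
        (simp_all add: finite_block rademacher_coord_outside)
  next
    case False
    then have "rademacher_coord D n = (\<lambda>_. 0)"
      by (auto simp: rademacher_coord_def Let_def fun_eq_iff split: prod.split)
    then show ?thesis by simp
  qed
  then show ?thesis by (simp add: rademacher_vector_def Abs_ell1_inverse)
qed

lemma coord_sum_rademacher_vector:
  "coord (\<Sum>n\<in>A. t n *\<^sub>R rademacher_vector D n) j = (\<Sum>n\<in>A. t n * rademacher_coord D n j)"
  by (induction A rule: infinite_finite_induct) (simp_all add: coord_rademacher_vector)

lemma norm_sum_rademacher_vector:
  "norm (\<Sum>n\<in>D k. t n *\<^sub>R rademacher_vector D n)
    = (\<Sum>S\<in>Pow (D k). \<bar>\<Sum>n\<in>D k. t n * rademacher n S\<bar>) / 2 ^ card (D k)"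
proof -
  let ?a = "\<lambda>j. \<bar>\<Sum>n\<in>D k. t n * rademacher_coord D n j\<bar>"
  have "norm (\<Sum>n\<in>D k. t n *\<^sub>R rademacher_vector D n) = (\<Sum>j. ?a j)"
    by (simp add: norm_ell1_def coord_sum_rademacher_vector)
  also have "\<dots> = (\<Sum>j\<in>block_index k ` Pow (D k). ?a j)"
    by (rule suminf_finite) (simp_all add: finite_block rademacher_coord_outside)
  also have "\<dots> = (\<Sum>S\<in>Pow (D k). ?a (block_index k S))"
    by (simp add: sum.reindex[OF inj_on_block_index[OF finite_block]])
  also have "\<dots> = (\<Sum>S\<in>Pow (D k). \<bar>\<Sum>n\<in>D k. t n * rademacher n S\<bar> / 2 ^ card (D k))"
  proof (rule sum.cong[OF refl])
    fix S assume "S \<in> Pow (D k)"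
    then have "S \<subseteq> D k" "finite S" using finite_block by (auto intro: finite_subset)
    then show "?a (block_index k S) = \<bar>\<Sum>n\<in>D k. t n * rademacher n S\<bar> / 2 ^ card (D k)"
      by (simp add: rademacher_coord_block_index sum_divide_distrib[symmetric])
  qed
  finally show ?thesis by (simp add: sum_divide_distrib)
qed

lemma norm_rademacher_vector:
  assumes "n \<in> I"
  shows "norm (rademacher_vector D n) = 1"
proof -
  obtain k where n: "n \<in> D k" using assms D by (auto simp: blocking_def)
  \<comment> \<open>Indicator coefficients single out one vector, whose norm is the mean of the
    absolute value of one sign.\<close>
  let ?t = "\<lambda>i. if i = n then 1 else 0 :: real"
  have 1: "(\<Sum>i\<in>D k. ?t i *\<^sub>R rademacher_vector D i) = rademacher_vector D n"
  proof -
    have "(\<Sum>i\<in>D k. ?t i *\<^sub>R rademacher_vector D i)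
        = (\<Sum>i\<in>D k. if i = n then rademacher_vector D i else 0)"
      by (rule sum.cong) auto
    then show ?thesis using n finite_block by simp
  qed
  have 2: "\<bar>\<Sum>i\<in>D k. ?t i * rademacher i S\<bar> = 1" for S
  proof -
    have "(\<Sum>i\<in>D k. ?t i * rademacher i S) = (\<Sum>i\<in>D k. if i = n then rademacher i S else 0)"
      by (rule sum.cong) auto
    then show ?thesis using n finite_block by (simp add: rademacher_def)
  qed
  show ?thesis
    using norm_sum_rademacher_vector[of ?t k] unfolding 1 2
    by (simp add: card_Pow finite_block)
qed

text \<open>Testing \<open>f\<close> on the combination with coefficients
  \<open>f (rademacher_vector D n)\<close> gives the sum of squares \<open>s\<close>, while the norm
  of that combination is at most \<open>sqrt s\<close>. So \<open>s\<close> is at most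
  \<open>onorm f * sqrt s\<close>, whatever the size of the block.\<close>

lemma rademacher_bessel:
  assumes f: "bounded_linear (f :: ell1 \<Rightarrow> real)"
  shows "(\<Sum>n\<in>D k. (f (rademacher_vector D n))\<^sup>2) \<le> (onorm f)\<^sup>2"
proof -
  define a where "a n = f (rademacher_vector D n)" for n
  define s where "s = (\<Sum>n\<in>D k. (a n)\<^sup>2)"
  interpret f: bounded_linear f by (rule f)
  have s0: "s \<ge> 0" by (simp add: s_def sum_nonneg)
  have "norm (\<Sum>n\<in>D k. a n *\<^sub>R rademacher_vector D n) \<le> sqrt s"
    using sum_Pow_rademacher_abs_le[OF finite_block, of a k]
    by (simp add: norm_sum_rademacher_vector s_def divide_le_eq mult.commute)
  then have "onorm f * norm (\<Sum>n\<in>D k. a n *\<^sub>R rademacher_vector D n) \<le> onorm f * sqrt s"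
    by (rule mult_left_mono) (rule onorm_pos_le[OF f])
  moreover have "f (\<Sum>n\<in>D k. a n *\<^sub>R rademacher_vector D n) = s"
    by (simp add: f.sum f.scaleR s_def a_def power2_eq_square)
  ultimately have "s \<le> onorm f * sqrt s"
    using onorm[OF f, of "\<Sum>n\<in>D k. a n *\<^sub>R rademacher_vector D n"] by simp
  then have "sqrt s * sqrt s \<le> onorm f * sqrt s" using s0 by simp
  then have "sqrt s \<le> onorm f"
  proof (cases "s = 0")
    case True
    then show ?thesis by (simp add: onorm_pos_le[OF f])
  next
    case False
    then have "sqrt s > 0" using s0 by simp
    with \<open>sqrt s * sqrt s \<le> onorm f * sqrt s\<close> show ?thesis by (rule mult_right_le_imp_le)
  qed
  then have "(sqrt s)\<^sup>2 \<le> (onorm f)\<^sup>2" using s0 by (intro power_mono) auto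
  then show ?thesis using s0 by (simp add: s_def a_def)
qed

text \<open>A Chebyshev count from Bessel's inequality. The bound is the same for every
  \<open>k\<close>, which is what the covering by finitely many selectors requires.\<close>

lemma card_rademacher_large:
  assumes f: "bounded_linear (f :: ell1 \<Rightarrow> real)" and e: "e > 0"
  shows "card {n \<in> D k. e \<le> \<bar>f (rademacher_vector D n)\<bar>} \<le> nat \<lfloor>(onorm f)\<^sup>2 / e\<^sup>2\<rfloor>"
proof -
  let ?T = "{n \<in> D k. e \<le> \<bar>f (rademacher_vector D n)\<bar>}"
  have "real (card ?T) * e\<^sup>2 = (\<Sum>n\<in>?T. e\<^sup>2)" by simp
  also have "\<dots> \<le> (\<Sum>n\<in>?T. (f (rademacher_vector D n))\<^sup>2)"
    by (rule sum_mono) (use e in \<open>simp add: abs_le_square_iff[symmetric]\<close>)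
  also have "\<dots> \<le> (\<Sum>n\<in>D k. (f (rademacher_vector D n))\<^sup>2)"
    by (rule sum_mono2) (auto simp: finite_block)
  also have "\<dots> \<le> (onorm f)\<^sup>2" by (rule rademacher_bessel[OF f])
  finally have "real (card ?T) \<le> (onorm f)\<^sup>2 / e\<^sup>2" using e by (simp add: le_divide_eq)
  then show ?thesis by (simp add: le_nat_floor)
qed

text \<open>Each coordinate belongs to a single block, and only the finitely many indices in that
  block can be nonzero there.\<close>

lemma coord_rademacher_vector_tendsto: "(\<lambda>n. coord (rademacher_vector D n) j) \<longlonglongrightarrow> 0"
proof -
  obtain k s where "prod_decode j = (k, s)" by fastforce
  then have "coord (rademacher_vector D n) j = 0" if "n \<notin> D k" for n
    using that by (simp add: coord_rademacher_vector rademacher_coord_def)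
  moreover obtain M where "D k \<subseteq> {..<M}" using finite_block by (meson finite_nat_iff_bounded)
  ultimately have "coord (rademacher_vector D n) j = 0" if "n \<ge> M" for n
    using that by force
  then show ?thesis
    by (intro tendsto_eventually eventually_sequentiallyI)
qed

lemma rademacher_vector_outside: "n \<notin> I \<Longrightarrow> rademacher_vector D n = 0"
  using D by (intro ell1_eqI)
    (auto simp: coord_rademacher_vector rademacher_coord_def Let_def blocking_def split: prod.split)

end

section \<open>From norm convergence to stationary selectors\<close>

lemma simplified_schur_imp_block_respecting:
  assumes F: "simplified_schur F"
  shows "block_respecting F"
  unfolding block_respecting_def
proof (intro allI impI)
  fix I D assume I: "stationary F I" and D: "blocking I D"
  let ?x = "rademacher_vector D"
  show "\<exists>J. stationary F J \<and> J \<subseteq> I \<and> (\<forall>k. card (J \<inter> D k) = 1)"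
  proof (rule ccontr)
    \<comment> \<open>Without a stationary selector the Rademacher vectors would be weakly null
      along \<open>F\<close>, although their norm is 1 on the stationary set
      \<open>I\<close>.\<close>
    assume none: "\<not> ?thesis"
    have "limitin weak_topology ?x 0 F"
      unfolding limitin_weak_topology_iff
    proof (intro allI impI)
      fix f :: "ell1 \<Rightarrow> real" assume f: "bounded_linear f"
      have f0: "f 0 = 0" using f by (simp add: linear_simps)
      have "eventually (\<lambda>n. \<bar>f (?x n)\<bar> < e) F" if e: "e > 0" for e
      proof (rule ccontr)
        assume *: "\<not> ?thesis"
        \<comment> \<open>\<open>T\<close> lies in \<open>I\<close> because the vectors vanish
          elsewhere, and it has boundedly many points in each block. Being stationary, it would
          yield a stationary selector, against \<open>none\<close>.\<close>
        define T where "T = {n. e \<le> \<bar>f (?x n)\<bar>}"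
        have "stationary F T"
          using * by (simp add: stationary_iff_frequently frequently_def T_def not_le)
        moreover have "T \<subseteq> I"
          using e f0 rademacher_vector_outside[OF D] by (force simp: T_def)
        moreover have "card (T \<inter> D k) \<le> nat \<lfloor>(onorm f)\<^sup>2 / e\<^sup>2\<rfloor>" for k
          using card_rademacher_large[OF D f e, of k] by (simp add: T_def Int_def conj_commute)
        ultimately show False
          using stationary_selector_of_bounded[OF D] none by blast
      qed
      then show "((\<lambda>n. f (?x n)) \<longlongrightarrow> f 0) F" by (simp add: tendsto_iff f0)
    qed
    then have "((\<lambda>n. norm (?x n)) \<longlongrightarrow> 0) F"
      using F coord_rademacher_vector_tendsto[OF D] unfolding simplified_schur_def by blast
    then have "eventually (\<lambda>n. norm (?x n) < 1) F"
      by (rule order_tendstoD) simp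
    then have "eventually (\<lambda>n. n \<notin> I) F"
      by (rule eventually_mono) (use norm_rademacher_vector[OF D] in force)
    then show False using I by (simp add: stationary_iff_frequently frequently_def)
  qed
qed

theorem theorem2p6:
  fixes F :: "nat filter"
  assumes "F \<noteq> bot"
    and "free_filter F"
  shows "simplified_schur F \<longleftrightarrow> block_respecting F"
  using simplified_schur_imp_block_respecting block_respecting_imp_simplified_schur[OF assms(2)]
  by blast

end
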